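(* Let $G$ be a connected weighted graph with a cluster $(C,S)$, $|C|=c$, let $H$ be a weighted graph with vertex set $C$ such that $\mathbf{1}_c$ is an eigenvector of $M(H)$, and let $G(H)$ be the graph obtained from $G$ by adding the edges of $H$ on $C$. Let $a\ne b$ and $f\neq d$ be vertices in $C$. Perfect state transfer occurs between $\mathbf{e}_a-\mathbf{e}_b$ and $\mathbf{e}_f-\mathbf{e}_d$ in $H$ if and only if it occurs between them in $G(H)$, at the same time. This holds for all of $M=A$, $M=L$ and $M=Q$ whenever $H$ is a regular graph.
   Context: A weighted graph has positive edge weights; its adjacency matrix $A$ has $A_{ij}$ equal to the weight of edge $ij$ (0 if no edge), $\Delta$ is the diagonal matrix of row sums of $A$, $L=\Delta-A$, $Q=\Delta+A$. $M$ denotes any one of $A,L,Q$ (same choice for all graphs), and $U_X(t)=\exp(itM(X))$. Perfect state transfer between real vectors $\mathbf{x},\mathbf{y}$ in a graph $X$ at time $\tau>0$ means $U_X(\tau)\mathbf{x}=\gamma\mathbf{y}$ for some $\gamma\in\mathbb{C}$. $\mathbf{e}_a$ is the characteristic vector of vertex $a$ (in the relevant graph). Cluster: for $C,S\subseteq V(G)$ with $|C|\ge2$, $(C,S)$ is a cluster in $G$ if the vertices of $C$ are pairwise non-adjacent, the neighbourhood of each $a\in C$ in $G$ is equal to $S$, and for each $v\in S$ the weight $\omega(u,v)$ is the same for all $u\in C$. $G(H)$ has vertex set $V(G)$ and edge set $E(G)\cup E(H)$, with edge weights preserved. $\mathbf{1}_c$ is the all-ones vector of length $c$. *)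

theory Defs
  imports Complex_Main
begin

record 'v wgraph =
  verts :: "'v set"
  edges :: "'v set set"
  weight :: "'v set \<Rightarrow> real"

text \<open>Finite, undirected and loopless; the values of \<open>weight\<close> outside \<open>edges\<close> are
  irrelevant.\<close>

definition weighted_graph :: "'v wgraph \<Rightarrow> bool" where
  "weighted_graph X \<longleftrightarrow>
     finite (verts X) \<and>
     (\<forall>e\<in>edges X. e \<subseteq> verts X \<and> card e = 2 \<and> 0 < weight X e)"

definition graph_connected :: "'v wgraph \<Rightarrow> bool" where
  "graph_connected X \<longleftrightarrow>
     (\<forall>u\<in>verts X. \<forall>v\<in>verts X. (u, v) \<in> {(x, y). {x, y} \<in> edges X}\<^sup>*)"

definition neighbourhood :: "'v wgraph \<Rightarrow> 'v \<Rightarrow> 'v set" where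
  "neighbourhood X a = {v \<in> verts X. {a, v} \<in> edges X}"

definition cluster :: "'v wgraph \<Rightarrow> 'v set \<Rightarrow> 'v set \<Rightarrow> bool" where
  "cluster X C S \<longleftrightarrow>
     C \<subseteq> verts X \<and> S \<subseteq> verts X \<and> 2 \<le> card C \<and>
     (\<forall>a\<in>C. \<forall>b\<in>C. {a, b} \<notin> edges X) \<and>
     (\<forall>a\<in>C. neighbourhood X a = S) \<and>
     (\<forall>v\<in>S. \<forall>u\<in>C. \<forall>u'\<in>C. weight X {u, v} = weight X {u', v})"

text \<open>The graph \<open>G(H)\<close>. An edge common to \<open>G\<close> and \<open>H\<close> would get its weight from \<open>H\<close>; there is
  none when \<open>H\<close> lives on a set of pairwise non-adjacent vertices of \<open>G\<close>.\<close>

definition add_graph :: "'v wgraph \<Rightarrow> 'v wgraph \<Rightarrow> 'v wgraph" where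
  "add_graph G H =
     \<lparr>verts = verts G, edges = edges G \<union> edges H,
      weight = (\<lambda>e. if e \<in> edges H then weight H e else weight G e)\<rparr>"

text \<open>A matrix with rows and columns indexed by a finite set \<open>V\<close> is a function of two arguments,
  and a vector indexed by \<open>V\<close> a function of one argument, of which only the values on \<open>V\<close>
  matter.\<close>

definition adj_matrix :: "'v wgraph \<Rightarrow> 'v \<Rightarrow> 'v \<Rightarrow> real" where
  "adj_matrix X u v = (if {u, v} \<in> edges X then weight X {u, v} else 0)"

definition row_sum :: "'v wgraph \<Rightarrow> 'v \<Rightarrow> real" where
  "row_sum X u = (\<Sum>v\<in>verts X. adj_matrix X u v)"

definition degree_matrix :: "'v wgraph \<Rightarrow> 'v \<Rightarrow> 'v \<Rightarrow> real" where
  "degree_matrix X u v = (if u = v then row_sum X u else 0)"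

datatype matrix_kind = Adjacency | Laplacian | Signless_Laplacian

fun graph_matrix :: "matrix_kind \<Rightarrow> 'v wgraph \<Rightarrow> 'v \<Rightarrow> 'v \<Rightarrow> real" where
  "graph_matrix Adjacency X u v = adj_matrix X u v"
| "graph_matrix Laplacian X u v = degree_matrix X u v - adj_matrix X u v"
| "graph_matrix Signless_Laplacian X u v = degree_matrix X u v + adj_matrix X u v"

text \<open>Weighted regularity, i.e. constant row sums of the adjacency matrix; for unit weights this
  is regularity in the usual sense.\<close>

definition regular_graph :: "'v wgraph \<Rightarrow> bool" where
  "regular_graph X \<longleftrightarrow> (\<exists>k. \<forall>u\<in>verts X. row_sum X u = k)"

definition mat_vec :: "'v set \<Rightarrow> ('v \<Rightarrow> 'v \<Rightarrow> 'a) \<Rightarrow> ('v \<Rightarrow> 'a) \<Rightarrow> 'v \<Rightarrow> 'a::comm_semiring_1" where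
  "mat_vec V B x u = (\<Sum>v\<in>V. B u v * x v)"

definition is_eigenvector :: "'v set \<Rightarrow> ('v \<Rightarrow> 'v \<Rightarrow> real) \<Rightarrow> ('v \<Rightarrow> real) \<Rightarrow> bool" where
  "is_eigenvector V B x \<longleftrightarrow>
     (\<exists>v\<in>V. x v \<noteq> 0) \<and> (\<exists>\<mu>. \<forall>u\<in>V. mat_vec V B x u = \<mu> * x u)"

primrec mat_power :: "'v set \<Rightarrow> ('v \<Rightarrow> 'v \<Rightarrow> complex) \<Rightarrow> nat \<Rightarrow> 'v \<Rightarrow> 'v \<Rightarrow> complex" where
  "mat_power V B 0 = (\<lambda>u v. if u = v then 1 else 0)"
| "mat_power V B (Suc n) = (\<lambda>u v. \<Sum>w\<in>V. B u w * mat_power V B n w v)"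

definition mat_exp :: "'v set \<Rightarrow> ('v \<Rightarrow> 'v \<Rightarrow> complex) \<Rightarrow> 'v \<Rightarrow> 'v \<Rightarrow> complex" where
  "mat_exp V B u v = (\<Sum>n. mat_power V B n u v / fact n)"

lemma norm_mat_power_le:
  assumes "finite V" "u \<in> V"
  shows "norm (mat_power V B n u v) \<le> (\<Sum>x\<in>V. \<Sum>y\<in>V. norm (B x y)) ^ n"
  using assms(2)
proof (induction n arbitrary: u)
  case 0
  then show ?case by simp
next
  case (Suc n)
  let ?K = "\<Sum>x\<in>V. \<Sum>y\<in>V. norm (B x y)"
  have "norm (mat_power V B (Suc n) u v) \<le> (\<Sum>w\<in>V. norm (B u w) * norm (mat_power V B n w v))"
    by (simp add: norm_mult[symmetric] norm_sum)
  also have "\<dots> \<le> (\<Sum>w\<in>V. norm (B u w) * ?K ^ n)"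
    by (intro sum_mono mult_left_mono Suc.IH) auto
  also have "\<dots> = (\<Sum>w\<in>V. norm (B u w)) * ?K ^ n"
    by (simp add: sum_distrib_right)
  also have "\<dots> \<le> ?K * ?K ^ n"
    using assms(1) Suc.prems
    by (intro mult_right_mono member_le_sum[of u V "\<lambda>x. \<Sum>y\<in>V. norm (B x y)"]
        zero_le_power sum_nonneg) auto
  finally show ?case by simp
qed

lemma summable_mat_exp:
  assumes "finite V" "u \<in> V"
  shows "summable (\<lambda>n. mat_power V B n u v / fact n)"
proof (rule summable_comparison_test')
  let ?K = "\<Sum>x\<in>V. \<Sum>y\<in>V. norm (B x y)"
  show "summable (\<lambda>n. inverse (fact n) * ?K ^ n)"
    by (rule summable_exp)
  show "norm (mat_power V B n u v / fact n) \<le> inverse (fact n) * ?K ^ n" if "0 \<le> n" for n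
    using norm_mat_power_le[OF assms, of B n v]
    by (simp add: norm_divide divide_inverse mult.commute[of _ "inverse (fact n)"] norm_mult norm_inverse)
qed

definition transition_matrix ::
    "matrix_kind \<Rightarrow> 'v wgraph \<Rightarrow> real \<Rightarrow> 'v \<Rightarrow> 'v \<Rightarrow> complex" where
  "transition_matrix M X t =
     mat_exp (verts X) (\<lambda>u v. \<i> * of_real t * of_real (graph_matrix M X u v))"

definition perfect_state_transfer ::
    "matrix_kind \<Rightarrow> 'v wgraph \<Rightarrow> ('v \<Rightarrow> real) \<Rightarrow> ('v \<Rightarrow> real) \<Rightarrow> real \<Rightarrow> bool" where
  "perfect_state_transfer M X x y \<tau> \<longleftrightarrow>
     0 < \<tau> \<and>
     (\<exists>\<gamma>::complex. \<forall>u\<in>verts X.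
        mat_vec (verts X) (transition_matrix M X \<tau>) (\<lambda>v. of_real (x v)) u = \<gamma> * of_real (y u))"

definition char_vec :: "'v \<Rightarrow> 'v \<Rightarrow> real" where
  "char_vec a v = (if v = a then 1 else 0)"

end

(* All vertices of the cluster are joined to the rest of G in the same way. So M(G(H)) maps a vector
   supported on C with entries summing to zero to such a vector again, acting there as M(H) + k I
   for a constant k (the weight from a cluster vertex to S if M is L or Q, zero if M is A); the sum
   stays zero because the all-ones vector is an eigenvector of the symmetric matrix M(H). Hence on
   these vectors the two transition matrices differ only by the phase exp(i t k). *)

theory Submission
  imports Defs
begin

section \<open>Adding a multiple of the identity inside the matrix exponential\<close>

text \<open>Binomial theorem for the commuting matrices \<open>B\<close> and \<open>k\<close> times
  the identity. The row \<open>u\<close> varies in the induction because \<open>mat_power\<close>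
  multiplies by \<open>B\<close> from the left.\<close>

lemma mat_power_add_scalar:
  assumes "finite V" "u \<in> V"
  shows "mat_power V (\<lambda>u v. B u v + (if u = v then k else 0)) n u v =
    (\<Sum>i\<le>n. of_nat (n choose i) * k ^ (n - i) * mat_power V B i u v)"
  using assms(2)
proof (induction n arbitrary: u)
  case 0
  then show ?case by simp
next
  case (Suc n)
  define p where "p i = mat_power V B i u v" for i
  have B_sum: "(\<Sum>w\<in>V. B u w * (\<Sum>i\<le>n. of_nat (n choose i) * k ^ (n - i) * mat_power V B i w v))
      = (\<Sum>i\<le>n. of_nat (n choose i) * k ^ (n - i) * p (Suc i))"
    unfolding p_def mat_power.simps sum_distrib_left
    by (subst sum.swap) (simp add: mult_ac)
  \<comment> \<open>Prepares Pascal's rule: the sum may be extended to \<open>Suc n\<close> because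
    \<open>n choose Suc n\<close> is 0, and then its term at 0 is split off.\<close>
  have shift: "(\<Sum>i\<le>n. of_nat (n choose Suc i) * k ^ (n - i) * p (Suc i)) + k ^ Suc n * p 0
      = k * (\<Sum>i\<le>n. of_nat (n choose i) * k ^ (n - i) * p i)"
  proof -
    have "k * (\<Sum>i\<le>n. of_nat (n choose i) * k ^ (n - i) * p i)
        = (\<Sum>i\<le>n. of_nat (n choose i) * k ^ (Suc n - i) * p i)"
      by (simp add: sum_distrib_left Suc_diff_le mult_ac)
    also have "\<dots> = (\<Sum>i\<le>Suc n. of_nat (n choose i) * k ^ (Suc n - i) * p i)"
      by (simp add: binomial_eq_0)
    also have "\<dots> = (\<Sum>i\<le>n. of_nat (n choose Suc i) * k ^ (n - i) * p (Suc i)) + k ^ Suc n * p 0"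
      by (subst sum.atMost_Suc_shift) simp
    finally show ?thesis by simp
  qed
  have "mat_power V (\<lambda>u v. B u v + (if u = v then k else 0)) (Suc n) u v
      = (\<Sum>w\<in>V. (B u w + (if u = w then k else 0)) *
          (\<Sum>i\<le>n. of_nat (n choose i) * k ^ (n - i) * mat_power V B i w v))"
    using Suc.IH by (simp cong: sum.cong)
  also have "\<dots> = (\<Sum>i\<le>n. of_nat (n choose i) * k ^ (n - i) * p (Suc i))
      + k * (\<Sum>i\<le>n. of_nat (n choose i) * k ^ (n - i) * p i)"
    unfolding distrib_right sum.distrib B_sum
    using assms(1) Suc.prems by (simp add: if_distrib[where f = "\<lambda>x. x * _"] p_def cong: if_cong)
  \<comment> \<open>Pascal's rule merges the two sums; the leftover \<open>k ^ Suc n * p 0\<close>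
    is the term at index 0 of the new expansion.\<close>
  also have "\<dots> = (\<Sum>i\<le>n. of_nat (Suc n choose Suc i) * k ^ (n - i) * p (Suc i)) + k ^ Suc n * p 0"
    unfolding shift[symmetric] by (simp add: sum.distrib algebra_simps)
  also have "\<dots> = (\<Sum>i\<le>Suc n. of_nat (Suc n choose i) * k ^ (Suc n - i) * p i)"
    by (subst sum.atMost_Suc_shift) simp
  finally show ?case unfolding p_def .
qed

text \<open>The exponential series that dominates the entries also dominates their norms. Absolute
  convergence is what the Cauchy product below requires.\<close>

lemma summable_norm_mat_exp:
  assumes "finite V" "u \<in> V"
  shows "summable (\<lambda>n. norm (mat_power V B n u v / fact n))"
proof (rule summable_comparison_test')
  let ?K = "\<Sum>x\<in>V. \<Sum>y\<in>V. norm (B x y)"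
  show "summable (\<lambda>n. inverse (fact n) * ?K ^ n)"
    by (rule summable_exp)
  show "norm (norm (mat_power V B n u v / fact n)) \<le> inverse (fact n) * ?K ^ n" for n
    using norm_mat_power_le[OF assms, of B n v]
    by (simp add: norm_divide norm_mult norm_inverse divide_inverse mult.commute)
qed

text \<open>After division by \<open>fact n\<close> the binomial expansion is a convolution, so the
  series is the Cauchy product of the series for \<open>mat_exp V B\<close> and for
  \<open>exp k\<close>.\<close>

lemma mat_exp_add_scalar:
  assumes "finite V" "u \<in> V"
  shows "mat_exp V (\<lambda>u v. B u v + (if u = v then k else 0)) u v = exp k * mat_exp V B u v"
proof -
  have term_eq: "mat_power V (\<lambda>u v. B u v + (if u = v then k else 0)) n u v / fact n
      = (\<Sum>i\<le>n. (mat_power V B i u v / fact i) * (k ^ (n - i) /\<^sub>R fact (n - i)))" for n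
    unfolding mat_power_add_scalar[OF assms] sum_divide_distrib
    by (rule sum.cong) (simp_all add: binomial_fact scaleR_conv_of_real field_simps)
  have "(\<lambda>n. \<Sum>i\<le>n. (mat_power V B i u v / fact i) * (k ^ (n - i) /\<^sub>R fact (n - i)))
      sums ((\<Sum>n. mat_power V B n u v / fact n) * (\<Sum>n. k ^ n /\<^sub>R fact n))"
    by (rule Cauchy_product_sums[OF summable_norm_mat_exp[OF assms] summable_norm_exp])
  then show ?thesis
    unfolding mat_exp_def term_eq exp_def by (simp add: sums_iff mult.commute)
qed

section \<open>Action on zero-sum vectors supported on a block\<close>

lemma mat_vec_mat_power_Suc:
  "mat_vec V (mat_power V B (Suc n)) x u = mat_vec V B (mat_vec V (mat_power V B n) x) u"
  unfolding mat_vec_def mat_power.simps sum_distrib_left sum_distrib_right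
  by (subst sum.swap) (simp add: mult_ac)

text \<open>A finite sum commutes with convergent series. Facts about powers applied to
  \<open>x\<close> thereby carry over to the exponential term by term.\<close>

lemma mat_vec_mat_exp:
  assumes "finite V" "u \<in> V"
  shows "mat_vec V (mat_exp V B) x u = (\<Sum>n. mat_vec V (mat_power V B n) x u / fact n)"
proof -
  have "mat_vec V (mat_exp V B) x u = (\<Sum>v\<in>V. \<Sum>n. mat_power V B n u v / fact n * x v)"
    unfolding mat_vec_def mat_exp_def
    by (rule sum.cong) (simp_all add: suminf_mult2[OF summable_mat_exp[OF assms]])
  also have "\<dots> = (\<Sum>n. \<Sum>v\<in>V. mat_power V B n u v / fact n * x v)"
    by (rule suminf_sum[symmetric]) (intro summable_mult2 summable_mat_exp assms)
  finally show ?thesis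
    by (simp add: mat_vec_def sum_divide_distrib)
qed

text \<open>Constant column sums make the all-ones vector a left eigenvector of \<open>B\<close>, so
  its orthogonal complement is invariant under \<open>B\<close>.\<close>

lemma sum_mat_vec_eq_0:
  assumes col_sum: "\<And>v. v \<in> C \<Longrightarrow> (\<Sum>u\<in>C. B u v) = \<mu>"
    and "(\<Sum>v\<in>C. x v) = 0"
  shows "(\<Sum>u\<in>C. mat_vec C B x u) = 0"
proof -
  have "(\<Sum>u\<in>C. mat_vec C B x u) = (\<Sum>v\<in>C. (\<Sum>u\<in>C. B u v) * x v)"
    unfolding mat_vec_def sum_distrib_right by (rule sum.swap)
  also have "\<dots> = \<mu> * (\<Sum>v\<in>C. x v)"
    by (simp add: col_sum sum_distrib_left)
  finally show ?thesis
    using assms(2) by simp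
qed

text \<open>The two conclusions are proved by one induction. Support in \<open>C\<close> and zero
  sum are preserved together: a row of \<open>B'\<close> outside \<open>C\<close> is constant on
  \<open>C\<close>, so it annihilates a zero-sum vector supported there.\<close>

lemma mat_vec_mat_power_restrict:
  assumes "finite V" "C \<subseteq> V"
    and block: "\<And>u v. u \<in> C \<Longrightarrow> v \<in> C \<Longrightarrow> B' u v = B u v"
    and rows: "\<And>u v. u \<in> V - C \<Longrightarrow> v \<in> C \<Longrightarrow> B' u v = c u"
    and cols: "\<And>v. v \<in> C \<Longrightarrow> (\<Sum>u\<in>C. B u v) = \<mu>"
    and supp: "\<And>v. v \<in> V - C \<Longrightarrow> x v = 0"
    and x_sum: "(\<Sum>v\<in>C. x v) = 0"
  shows "u \<in> V \<Longrightarrow> mat_vec V (mat_power V B' n) x u =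
      (if u \<in> C then mat_vec C (mat_power C B n) x u else 0)"
    and "(\<Sum>u\<in>C. mat_vec C (mat_power C B n) x u) = 0"
proof -
  have fin_C: "finite C"
    using assms(1,2) finite_subset by blast
  have zero: "mat_vec W (mat_power W D 0) x u = x u" if "finite W" "u \<in> W"
    for W u and D :: "'a \<Rightarrow> 'a \<Rightarrow> complex"
    using that by (simp add: mat_vec_def if_distrib[where f = "\<lambda>y. y * _"] cong: if_cong)
  have "(\<forall>u\<in>V. mat_vec V (mat_power V B' n) x u =
          (if u \<in> C then mat_vec C (mat_power C B n) x u else 0)) \<and>
        (\<Sum>u\<in>C. mat_vec C (mat_power C B n) x u) = 0"
  proof (induction n)
    case 0
    have "(\<Sum>u\<in>C. mat_vec C (mat_power C B 0) x u) = (\<Sum>u\<in>C. x u)"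
      by (intro sum.cong refl zero fin_C)
    then show ?case
      using zero[OF assms(1)] zero[OF fin_C] supp x_sum by (simp del: mat_power.simps)
  next
    case (Suc n)
    define y where "y = mat_vec C (mat_power C B n) x"
    \<comment> \<open>By the induction hypothesis the current vector vanishes outside
      \<open>C\<close>, so only the columns of \<open>B'\<close> in \<open>C\<close>
      contribute.\<close>
    have step: "mat_vec V (mat_power V B' (Suc n)) x u = (\<Sum>v\<in>C. B' u v * y v)" for u
    proof -
      have "mat_vec V (mat_power V B' (Suc n)) x u = (\<Sum>v\<in>V. B' u v * (if v \<in> C then y v else 0))"
        unfolding mat_vec_mat_power_Suc y_def
        by (subst mat_vec_def) (use Suc.IH in \<open>simp cong: sum.cong\<close>)
      also have "\<dots> = (\<Sum>v\<in>C. B' u v * (if v \<in> C then y v else 0))"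
        using assms(1,2) by (intro sum.mono_neutral_right) auto
      finally show ?thesis by simp
    qed
    have y_sum: "(\<Sum>v\<in>C. y v) = 0"
      using Suc.IH by (simp add: y_def)
    show ?case
    proof (intro conjI ballI)
      fix u assume "u \<in> V"
      show "mat_vec V (mat_power V B' (Suc n)) x u =
          (if u \<in> C then mat_vec C (mat_power C B (Suc n)) x u else 0)"
      proof (cases "u \<in> C")
        case True
        have "mat_vec C (mat_power C B (Suc n)) x u = (\<Sum>v\<in>C. B u v * y v)"
          unfolding mat_vec_mat_power_Suc y_def by (rule mat_vec_def)
        then show ?thesis
          using True step block by (simp del: mat_power.simps cong: sum.cong)
      next
        case False
        \<comment> \<open>The constant entry \<open>c u\<close> factors out and leaves the sum of
          \<open>y\<close>, which is 0.\<close>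
        then have "(\<Sum>v\<in>C. B' u v * y v) = c u * (\<Sum>v\<in>C. y v)"
          using rows \<open>u \<in> V\<close> by (simp add: sum_distrib_left)
        then show ?thesis
          using False y_sum step by (simp del: mat_power.simps)
      qed
    next
      show "(\<Sum>u\<in>C. mat_vec C (mat_power C B (Suc n)) x u) = 0"
        unfolding mat_vec_mat_power_Suc y_def[symmetric]
        by (rule sum_mat_vec_eq_0[OF cols y_sum])
    qed
  qed
  then show "u \<in> V \<Longrightarrow> mat_vec V (mat_power V B' n) x u =
      (if u \<in> C then mat_vec C (mat_power C B n) x u else 0)"
    and "(\<Sum>u\<in>C. mat_vec C (mat_power C B n) x u) = 0"
    by auto
qed

text \<open>The restriction of powers is applied to \<open>B\<close> plus \<open>k\<close> times the
  identity, whose column sums are \<open>\<mu> + k\<close>; the diagonal shift then comes out of the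
  exponential as the factor \<open>exp k\<close>.\<close>

lemma mat_vec_mat_exp_restrict:
  assumes "finite V" "C \<subseteq> V"
    and block: "\<And>u v. u \<in> C \<Longrightarrow> v \<in> C \<Longrightarrow> B' u v = B u v + (if u = v then k else 0)"
    and rows: "\<And>u v. u \<in> V - C \<Longrightarrow> v \<in> C \<Longrightarrow> B' u v = c u"
    and cols: "\<And>v. v \<in> C \<Longrightarrow> (\<Sum>u\<in>C. B u v) = \<mu>"
    and supp: "\<And>v. v \<in> V - C \<Longrightarrow> x v = 0"
    and x_sum: "(\<Sum>v\<in>C. x v) = 0"
    and "u \<in> V"
  shows "mat_vec V (mat_exp V B') x u =
      (if u \<in> C then exp k * mat_vec C (mat_exp C B) x u else 0)"
proof -
  let ?B = "\<lambda>u v. B u v + (if u = v then k else 0)"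
  have fin_C: "finite C"
    using assms(1,2) finite_subset by blast
  have cols': "(\<Sum>u\<in>C. ?B u v) = \<mu> + k" if "v \<in> C" for v
    using that fin_C by (simp add: sum.distrib cols)
  have power: "mat_vec V (mat_power V B' n) x u =
      (if u \<in> C then mat_vec C (mat_power C ?B n) x u else 0)" for n
    by (rule mat_vec_mat_power_restrict(1)[OF assms(1,2) block rows cols' supp x_sum \<open>u \<in> V\<close>])
  show ?thesis
  proof (cases "u \<in> C")
    case True
    have "mat_vec V (mat_exp V B') x u = mat_vec C (mat_exp C ?B) x u"
      using True by (simp add: mat_vec_mat_exp assms(1) \<open>u \<in> V\<close> fin_C power)
    also have "\<dots> = exp k * mat_vec C (mat_exp C B) x u"
      unfolding mat_vec_def using mat_exp_add_scalar[OF fin_C True]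
      by (simp add: sum_distrib_left mult.assoc)
    finally show ?thesis
      using True by simp
  next
    case False
    then show ?thesis
      by (simp add: mat_vec_mat_exp assms(1) \<open>u \<in> V\<close> power)
  qed
qed

section \<open>Entries of the matrices of G(H)\<close>

lemma adj_matrix_sym: "adj_matrix X u v = adj_matrix X v u"
  by (simp add: adj_matrix_def insert_commute)

lemma graph_matrix_sym: "graph_matrix M X u v = graph_matrix M X v u"
  by (cases M) (simp_all add: adj_matrix_sym[of X u v] degree_matrix_def)

text \<open>The degree matrix is diagonal, so off the diagonal every kind of matrix is the adjacency
  matrix up to a sign fixed by \<open>M\<close>.\<close>

lemma graph_matrix_off_diagonal_cong:
  assumes "u \<noteq> v" "u' \<noteq> v'" "adj_matrix X u v = adj_matrix Y u' v'"
  shows "graph_matrix M X u v = graph_matrix M Y u' v'"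
  using assms by (cases M) (simp_all add: degree_matrix_def)

text \<open>All cluster vertices have neighbourhood \<open>S\<close>, so whether \<open>w\<close> is
  adjacent to them depends only on \<open>w \<in> S\<close>; if it is, the weights agree by the
  cluster condition.\<close>

lemma adj_matrix_cluster_outside:
  assumes "cluster G C S" "w \<in> verts G" "u \<in> C" "u' \<in> C"
  shows "adj_matrix G u w = adj_matrix G u' w"
proof -
  have "{u, w} \<in> edges G \<longleftrightarrow> w \<in> S" "{u', w} \<in> edges G \<longleftrightarrow> w \<in> S"
    using assms unfolding cluster_def neighbourhood_def by blast+
  moreover have "weight G {u, w} = weight G {u', w}" if "w \<in> S"
    using assms that unfolding cluster_def by blast
  ultimately show ?thesis
    unfolding adj_matrix_def by presburger
qed

lemma adj_matrix_add_graph_inside: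
  assumes "cluster G C S" "u \<in> C" "v \<in> C"
  shows "adj_matrix (add_graph G H) u v = adj_matrix H u v"
proof -
  have "{u, v} \<notin> edges G"
    using assms unfolding cluster_def by blast
  then show ?thesis
    by (simp add: adj_matrix_def add_graph_def)
qed

lemma adj_matrix_add_graph_outside:
  assumes "weighted_graph H" "v \<notin> verts H"
  shows "adj_matrix (add_graph G H) u v = adj_matrix G u v"
proof -
  have "{u, v} \<notin> edges H"
    using assms by (auto simp: weighted_graph_def)
  then show ?thesis
    by (simp add: adj_matrix_def add_graph_def)
qed

text \<open>The row splits at \<open>C\<close>: inside, only edges of \<open>H\<close> occur because
  \<open>C\<close> is independent in \<open>G\<close>; outside, only edges of \<open>G\<close>
  occur.\<close>

lemma row_sum_add_graph:
  assumes "weighted_graph G" "weighted_graph H" "cluster G C S" "verts H = C" "u \<in> C"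
  shows "row_sum (add_graph G H) u = row_sum H u + (\<Sum>v\<in>verts G - C. adj_matrix G u v)"
proof -
  have "finite (verts G)" "C \<subseteq> verts G"
    using assms by (simp_all only: weighted_graph_def cluster_def)
  then have "row_sum (add_graph G H) u = (\<Sum>v\<in>verts G - C. adj_matrix (add_graph G H) u v)
      + (\<Sum>v\<in>C. adj_matrix (add_graph G H) u v)"
    by (simp add: row_sum_def add_graph_def sum.subset_diff)
  then show ?thesis
    using assms
    by (simp add: adj_matrix_add_graph_outside adj_matrix_add_graph_inside row_sum_def)
qed

lemma graph_matrix_add_graph_inside:
  assumes "weighted_graph G" "weighted_graph H" "cluster G C S" "verts H = C"
  obtains k where "\<And>u v. u \<in> C \<Longrightarrow> v \<in> C \<Longrightarrow>
    graph_matrix M (add_graph G H) u v = graph_matrix M H u v + (if u = v then k else 0)"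
proof -
  obtain a where "a \<in> C"
    using assms(3) by (force simp: cluster_def)
  \<comment> \<open>The total weight from a cluster vertex to the rest of \<open>G\<close>; by the
    cluster condition the choice of \<open>a\<close> is immaterial.\<close>
  define r where "r = (\<Sum>v\<in>verts G - C. adj_matrix G a v)"
  have "(\<Sum>v\<in>verts G - C. adj_matrix G u v) = r" if "u \<in> C" for u
    unfolding r_def
    using adj_matrix_cluster_outside[OF assms(3) _ that \<open>a \<in> C\<close>] by (intro sum.cong) auto
  then have row: "row_sum (add_graph G H) u = row_sum H u + r" if "u \<in> C" for u
    using row_sum_add_graph[OF assms that] that by simp
  show ?thesis
  proof (rule that)
    \<comment> \<open>The degree matrix enters both Laplacians with a plus sign, so the shift is
      \<open>r\<close> for both, and 0 for the adjacency matrix.\<close>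
    show "graph_matrix M (add_graph G H) u v =
        graph_matrix M H u v + (if u = v then (if M = Adjacency then 0 else r) else 0)"
      if "u \<in> C" "v \<in> C" for u v
      using that row adj_matrix_add_graph_inside[OF assms(3) that]
      by (cases M) (auto simp: degree_matrix_def)
  qed
qed

lemma graph_matrix_add_graph_outside:
  assumes "weighted_graph H" "cluster G C S" "verts H = C"
    and "u \<in> verts G - C" "v \<in> C" "v' \<in> C"
  shows "graph_matrix M (add_graph G H) u v = graph_matrix M (add_graph G H) u v'"
proof (rule graph_matrix_off_diagonal_cong)
  have outside: "adj_matrix (add_graph G H) u w = adj_matrix G w u" for w
    unfolding adj_matrix_sym[of "add_graph G H" u w]
    by (rule adj_matrix_add_graph_outside) (use assms in auto)
  show "adj_matrix (add_graph G H) u v = adj_matrix (add_graph G H) u v'"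
    unfolding outside by (rule adj_matrix_cluster_outside[OF assms(2)]) (use assms in auto)
qed (use assms in auto)

section \<open>Comparison of the transition matrices and of state transfer\<close>

text \<open>The block lemma is instantiated with the matrices multiplied by
  \<open>\<i> * of_real t\<close>, which turns the shift \<open>k\<close> into a phase. One
  \<open>k\<close> serves all times and vectors.\<close>

lemma transition_matrix_add_graph:
  assumes "weighted_graph G" "weighted_graph H" "cluster G C S" "verts H = C"
    and eigen: "is_eigenvector C (graph_matrix M H) (\<lambda>_. 1)"
  obtains k :: real where "\<And>t x u. \<lbrakk>\<And>v. v \<in> verts G - C \<Longrightarrow> x v = 0; (\<Sum>v\<in>C. x v) = 0; u \<in> verts G\<rbrakk> \<Longrightarrow>
    mat_vec (verts G) (transition_matrix M (add_graph G H) t) x u =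
      (if u \<in> C then exp (\<i> * of_real t * of_real k) * mat_vec C (transition_matrix M H t) x u else 0)"
proof -
  obtain k where k: "\<And>u v. u \<in> C \<Longrightarrow> v \<in> C \<Longrightarrow>
    graph_matrix M (add_graph G H) u v = graph_matrix M H u v + (if u = v then k else 0)"
    using graph_matrix_add_graph_inside[OF assms(1-4)] by blast
  obtain a where "a \<in> C"
    using assms(3) by (force simp: cluster_def)
  have fin: "finite (verts G)" and sub: "C \<subseteq> verts G"
    using assms by (simp_all only: weighted_graph_def cluster_def)
  have verts: "verts (add_graph G H) = verts G"
    by (simp add: add_graph_def)
  obtain \<mu> where "\<And>u. u \<in> C \<Longrightarrow> (\<Sum>v\<in>C. graph_matrix M H u v) = \<mu>"
    using eigen by (auto simp: is_eigenvector_def mat_vec_def)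
  \<comment> \<open>The eigenvector equation gives constant row sums; symmetry turns them into
    column sums.\<close>
  then have cols: "(\<Sum>u\<in>C. graph_matrix M H u v) = \<mu>" if "v \<in> C" for v
    using that by (simp add: graph_matrix_sym[of M H _ v])
  show ?thesis
  proof (rule that[of k])
    fix t u and x :: "'a \<Rightarrow> complex"
    assume x: "\<And>v. v \<in> verts G - C \<Longrightarrow> x v = 0" "(\<Sum>v\<in>C. x v) = 0" and u: "u \<in> verts G"
    show "mat_vec (verts G) (transition_matrix M (add_graph G H) t) x u =
      (if u \<in> C then exp (\<i> * of_real t * of_real k) * mat_vec C (transition_matrix M H t) x u else 0)"
      unfolding transition_matrix_def verts assms(4)
    proof (rule mat_vec_mat_exp_restrict[OF fin sub _ _ _ x u])
      show "\<i> * of_real t * of_real (graph_matrix M (add_graph G H) u v) =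
          \<i> * of_real t * of_real (graph_matrix M H u v) + (if u = v then \<i> * of_real t * of_real k else 0)"
        if "u \<in> C" "v \<in> C" for u v
        using k[OF that] by (simp add: algebra_simps)
      \<comment> \<open>The column of the fixed vertex \<open>a\<close> supplies the constant value
        of row \<open>u\<close> on \<open>C\<close>.\<close>
      show "\<i> * of_real t * of_real (graph_matrix M (add_graph G H) u v) =
          \<i> * of_real t * of_real (graph_matrix M (add_graph G H) u a)"
        if "u \<in> verts G - C" "v \<in> C" for u v
        using graph_matrix_add_graph_outside[OF assms(2-4) that \<open>a \<in> C\<close>, of M] by simp
      show "(\<Sum>u\<in>C. \<i> * of_real t * of_real (graph_matrix M H u v)) = \<i> * of_real t * of_real \<mu>"
        if "v \<in> C" for v
        using cols[OF that] by (simp flip: sum_distrib_left of_real_sum)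
    qed
  qed
qed

text \<open>The two evolutions of \<open>x\<close> differ on \<open>C\<close> by the nonzero factor
  \<open>e\<close>, which \<open>\<gamma>\<close> absorbs.\<close>

lemma perfect_state_transfer_add_graph:
  assumes "weighted_graph G" "weighted_graph H" "cluster G C S" "verts H = C"
    and "is_eigenvector C (graph_matrix M H) (\<lambda>_. 1)"
    and x: "\<And>v. v \<in> verts G - C \<Longrightarrow> x v = 0" "(\<Sum>v\<in>C. x v) = 0"
    and y: "\<And>v. v \<in> verts G - C \<Longrightarrow> y v = 0"
  shows "perfect_state_transfer M H x y \<tau> \<longleftrightarrow> perfect_state_transfer M (add_graph G H) x y \<tau>"
proof -
  obtain k :: real where k: "\<And>t x u. \<lbrakk>\<And>v. v \<in> verts G - C \<Longrightarrow> x v = 0; (\<Sum>v\<in>C. x v) = 0; u \<in> verts G\<rbrakk> \<Longrightarrow>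
    mat_vec (verts G) (transition_matrix M (add_graph G H) t) x u =
      (if u \<in> C then exp (\<i> * of_real t * of_real k) * mat_vec C (transition_matrix M H t) x u else 0)"
    using transition_matrix_add_graph[OF assms(1-5)] by blast
  define e where "e = exp (\<i> * of_real \<tau> * of_real k)"
  define h where "h = mat_vec C (transition_matrix M H \<tau>) (\<lambda>v. of_real (x v))"
  have "e \<noteq> 0"
    by (simp add: e_def)
  have sub: "C \<subseteq> verts G"
    using assms(3) by (simp add: cluster_def)
  have transition: "mat_vec (verts G) (transition_matrix M (add_graph G H) \<tau>) (\<lambda>v. of_real (x v)) u =
      (if u \<in> C then e * h u else 0)" if "u \<in> verts G" for u
    unfolding e_def h_def using x that
    by (intro k) (simp_all flip: of_real_sum)
  have "(\<exists>\<gamma>. \<forall>u\<in>C. h u = \<gamma> * of_real (y u)) \<longleftrightarrow> (\<exists>\<gamma>. \<forall>u\<in>C. e * h u = \<gamma> * of_real (y u))"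
  proof
    assume "\<exists>\<gamma>. \<forall>u\<in>C. h u = \<gamma> * of_real (y u)"
    then obtain \<gamma> where "\<forall>u\<in>C. h u = \<gamma> * of_real (y u)" ..
    then show "\<exists>\<gamma>. \<forall>u\<in>C. e * h u = \<gamma> * of_real (y u)"
      by (intro exI[of _ "e * \<gamma>"]) simp
  next
    assume "\<exists>\<gamma>. \<forall>u\<in>C. e * h u = \<gamma> * of_real (y u)"
    then obtain \<gamma> where "\<forall>u\<in>C. e * h u = \<gamma> * of_real (y u)" ..
    then show "\<exists>\<gamma>. \<forall>u\<in>C. h u = \<gamma> * of_real (y u)"
      using \<open>e \<noteq> 0\<close> by (intro exI[of _ "\<gamma> / e"]) (simp add: field_simps)
  qed
  \<comment> \<open>Outside \<open>C\<close> the target \<open>y\<close> vanishes too, so the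
    equations there read 0 = 0.\<close>
  moreover have "(\<forall>u\<in>verts G. (if u \<in> C then e * h u else 0) = \<gamma> * of_real (y u)) \<longleftrightarrow>
      (\<forall>u\<in>C. e * h u = \<gamma> * of_real (y u))" for \<gamma>
    using y sub by fastforce
  moreover have "verts (add_graph G H) = verts G"
    by (simp add: add_graph_def)
  ultimately show ?thesis
    using transition
    by (simp add: perfect_state_transfer_def assms(4) h_def[symmetric] cong: ball_cong)
qed

text \<open>If the adjacency matrix has row sums \<open>r\<close>, then \<open>M(H)\<close> has row
  sums \<open>r\<close>, 0 and \<open>2 * r\<close> for the three kinds in order.\<close>

lemma regular_graph_is_eigenvector_ones:
  assumes "weighted_graph H" "regular_graph H" "verts H \<noteq> {}"
  shows "is_eigenvector (verts H) (graph_matrix M H) (\<lambda>_. 1)"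
proof -
  obtain r where r: "\<And>u. u \<in> verts H \<Longrightarrow> (\<Sum>v\<in>verts H. adj_matrix H u v) = r"
    using assms(2) by (auto simp: regular_graph_def row_sum_def)
  have fin: "finite (verts H)"
    using assms(1) by (simp add: weighted_graph_def)
  have "\<exists>\<mu>. \<forall>u\<in>verts H. (\<Sum>v\<in>verts H. graph_matrix M H u v) = \<mu>"
    by (cases M) (auto simp: r fin sum_subtractf sum.distrib degree_matrix_def row_sum_def)
  then show ?thesis
    using assms(3) by (auto simp: is_eigenvector_def mat_vec_def)
qed

theorem corollary1:
  fixes G H :: "'v wgraph" and C S :: "'v set" and M :: matrix_kind and a b f d :: 'v
  assumes "weighted_graph G" and "graph_connected G" and "cluster G C S"
    and "weighted_graph H" and "verts H = C"
    and "a \<in> C" and "b \<in> C" and "a \<noteq> b"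
    and "f \<in> C" and "d \<in> C" and "f \<noteq> d"
  shows "(is_eigenvector C (graph_matrix M H) (\<lambda>_. 1) \<longrightarrow>
      (\<forall>\<tau>. perfect_state_transfer M H
              (\<lambda>v. char_vec a v - char_vec b v) (\<lambda>v. char_vec f v - char_vec d v) \<tau> \<longleftrightarrow>
            perfect_state_transfer M (add_graph G H)
              (\<lambda>v. char_vec a v - char_vec b v) (\<lambda>v. char_vec f v - char_vec d v) \<tau>)) \<and>
    (regular_graph H \<longrightarrow>
      (\<forall>M' \<tau>. perfect_state_transfer M' H
              (\<lambda>v. char_vec a v - char_vec b v) (\<lambda>v. char_vec f v - char_vec d v) \<tau> \<longleftrightarrow>
            perfect_state_transfer M' (add_graph G H)
              (\<lambda>v. char_vec a v - char_vec b v) (\<lambda>v. char_vec f v - char_vec d v) \<tau>))"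
proof -
  have fin: "finite C"
    using assms by (auto simp: weighted_graph_def)
  have supp: "char_vec p v - char_vec q v = 0" if "p \<in> C" "q \<in> C" "v \<in> verts G - C" for p q v
    using that by (auto simp: char_vec_def)
  have sum: "(\<Sum>v\<in>C. char_vec a v - char_vec b v) = 0"
    using \<open>a \<in> C\<close> \<open>b \<in> C\<close> fin by (simp add: sum_subtractf char_vec_def)
  \<comment> \<open>Stated for an arbitrary kind \<open>M'\<close>, so that it yields both the claim
    for the given \<open>M\<close> and the one for regular \<open>H\<close>.\<close>
  have transfer: "perfect_state_transfer M' H
          (\<lambda>v. char_vec a v - char_vec b v) (\<lambda>v. char_vec f v - char_vec d v) \<tau> \<longleftrightarrow>
        perfect_state_transfer M' (add_graph G H)
          (\<lambda>v. char_vec a v - char_vec b v) (\<lambda>v. char_vec f v - char_vec d v) \<tau>"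
    if "is_eigenvector C (graph_matrix M' H) (\<lambda>_. 1)" for M' \<tau>
    by (rule perfect_state_transfer_add_graph[OF assms(1,4,3,5) that
          supp[OF \<open>a \<in> C\<close> \<open>b \<in> C\<close>] sum supp[OF \<open>f \<in> C\<close> \<open>d \<in> C\<close>]])
  have "is_eigenvector C (graph_matrix M' H) (\<lambda>_. 1)" if "regular_graph H" for M'
    using regular_graph_is_eigenvector_ones[OF assms(4) that] assms(5,6) by auto
  then show ?thesis
    using transfer by blast
qed

end
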